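(* Let $G$ be the distribution of an exchangeable joint mix in $\mathbb R^n$ with center $\mu\in\mathbb R$. Then $G$ can be written as a mixture of distributions of exchangeable NA joint mixes with center $\mu$.
   Context: A random vector $\mathbf X=(X_1,\dots,X_n)$ is a joint mix with center $\mu$ if $\sum_{i=1}^nX_i=\mu$ almost surely. $\mathbf X$ (or its distribution) is exchangeable if $(X_{\pi(1)},\dots,X_{\pi(n)})$ has the same distribution as $\mathbf X$ for every permutation $\pi$ of $[n]=\{1,\dots,n\}$. $\mathbf X$ is negatively associated (NA) if $\mathrm{Cov}(f(\mathbf X_A),g(\mathbf X_B))\le 0$ for any disjoint $A,B\subseteq[n]$ and any real-valued coordinate-wise increasing (non-decreasing) functions $f,g$ such that $f(\mathbf X_A)$ and $g(\mathbf X_B)$ have finite second moments, where $\mathbf X_A=(X_i)_{i\in A}$. A distribution $G$ on $\mathbb R^n$ is a mixture of distributions in a class $\mathcal C$ if there are a probability space $(\Theta,\mathcal T,\nu)$ and a probability kernel $\theta\mapsto U_\theta$ from $\Theta$ to $\mathbb R^n$, with $U_\theta\in\mathcal C$ for $\nu$-almost every $\theta$, such that $G(A)=\int_\Theta U_\theta(A)\,\nu(\mathrm d\theta)$ for every Borel set $A\subseteq\mathbb R^n$. *)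

theory Defs
  imports "HOL-Probability.Probability" "HOL-Combinatorics.Permutations"
begin

text \<open>
  Random vectors in \<open>\<real>\<^sup>n\<close> are measurable maps into \<^typ>\<open>real ^ 'n\<close>; the finite type \<open>'n\<close> is the
  index set \<open>[n]\<close>.
\<close>

definition covariance :: "'a measure \<Rightarrow> ('a \<Rightarrow> real) \<Rightarrow> ('a \<Rightarrow> real) \<Rightarrow> real" where
  "covariance M Y Z =
     (LINT \<omega>|M. (Y \<omega> - (LINT \<omega>|M. Y \<omega>)) * (Z \<omega> - (LINT \<omega>|M. Z \<omega>)))"

definition finite_second_moment :: "'a measure \<Rightarrow> ('a \<Rightarrow> real) \<Rightarrow> bool" where
  "finite_second_moment M Y \<longleftrightarrow> Y \<in> borel_measurable M \<and> integrable M (\<lambda>\<omega>. (Y \<omega>)\<^sup>2)"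

definition joint_mix :: "'a measure \<Rightarrow> ('a \<Rightarrow> real ^ 'n) \<Rightarrow> real \<Rightarrow> bool" where
  "joint_mix M X \<mu> \<longleftrightarrow> (AE \<omega> in M. (\<Sum>i\<in>UNIV. X \<omega> $ i) = \<mu>)"

definition exchangeable :: "'a measure \<Rightarrow> ('a \<Rightarrow> real ^ 'n) \<Rightarrow> bool" where
  "exchangeable M X \<longleftrightarrow>
     (\<forall>\<pi>. \<pi> permutes UNIV \<longrightarrow> distr M borel (\<lambda>\<omega>. \<chi> i. X \<omega> $ \<pi> i) = distr M borel X)"

text \<open>
  The subvector \<open>X\<^sub>A\<close> is the restriction of \<open>i \<mapsto> X\<^sub>i\<close> to \<open>A\<close>, a point of \<open>A \<rightarrow>\<^sub>E UNIV\<close>. Functions in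
  this set agree outside \<open>A\<close>, so the pointwise order on it is the coordinate-wise order of \<open>\<real>\<^sup>A\<close>.
\<close>

definition subvector :: "'n set \<Rightarrow> real ^ 'n \<Rightarrow> 'n \<Rightarrow> real" where
  "subvector A x = restrict (\<lambda>i. x $ i) A"

text \<open>
  Increasing functions of several variables need not be Borel; only measurability of the composed
  random variables \<open>f(X\<^sub>A)\<close> and \<open>g(X\<^sub>B)\<close> is required (as part of having a finite second moment).
\<close>

definition negatively_associated :: "'a measure \<Rightarrow> ('a \<Rightarrow> real ^ 'n) \<Rightarrow> bool" where
  "negatively_associated M X \<longleftrightarrow>
     (\<forall>A B. \<forall>f g :: ('n \<Rightarrow> real) \<Rightarrow> real.
        A \<inter> B = {} \<longrightarrow>
        mono_on (A \<rightarrow>\<^sub>E UNIV) f \<longrightarrow> mono_on (B \<rightarrow>\<^sub>E UNIV) g \<longrightarrow>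
        finite_second_moment M (\<lambda>\<omega>. f (subvector A (X \<omega>))) \<longrightarrow>
        finite_second_moment M (\<lambda>\<omega>. g (subvector B (X \<omega>))) \<longrightarrow>
        covariance M (\<lambda>\<omega>. f (subvector A (X \<omega>))) (\<lambda>\<omega>. g (subvector B (X \<omega>))) \<le> 0)"

text \<open>
  The underlying probability space in the next definition is carried by \<^typ>\<open>real ^ 'n\<close>. This is no
  restriction: by lemma \<open>distr_in_exchangeable_NA_joint_mix_laws\<close> below, the set contains the law
  of every such random vector, whatever probability space it lives on.
\<close>

definition exchangeable_NA_joint_mix_laws :: "real \<Rightarrow> (real ^ 'n) measure set" where
  "exchangeable_NA_joint_mix_laws \<mu> =
     {distr N borel Y | (N :: (real ^ 'n) measure) (Y :: real ^ 'n \<Rightarrow> real ^ 'n).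
        prob_space N \<and> Y \<in> borel_measurable N \<and>
        exchangeable N Y \<and> negatively_associated N Y \<and> joint_mix N Y \<mu>}"

text \<open>
  \<open>\<nu>\<close> is the mixing probability on \<open>\<Theta> = space \<nu>\<close>. Measurability into \<^term>\<open>prob_algebra borel\<close> says
  that \<open>U\<close> is a probability kernel.
\<close>

definition is_mixture ::
  "'t measure \<Rightarrow> ('t \<Rightarrow> 'b::topological_space measure) \<Rightarrow> 'b measure set \<Rightarrow> 'b measure \<Rightarrow> bool" where
  "is_mixture \<nu> U C G \<longleftrightarrow>
     sets G = sets borel \<and> prob_space \<nu> \<and>
     U \<in> \<nu> \<rightarrow>\<^sub>M prob_algebra borel \<and> (AE \<theta> in \<nu>. U \<theta> \<in> C) \<and>
     (\<forall>A\<in>sets borel. emeasure G A = (\<integral>\<^sup>+\<theta>. emeasure (U \<theta>) A \<partial>\<nu>))"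

lemma distr_in_exchangeable_NA_joint_mix_laws:
  fixes X :: "'a \<Rightarrow> real ^ 'n"
  assumes M: "prob_space M" and X: "X \<in> borel_measurable M"
    and ex: "exchangeable M X" and na: "negatively_associated M X" and jm: "joint_mix M X \<mu>"
  shows "distr M borel X \<in> exchangeable_NA_joint_mix_laws \<mu>"
proof -
  let ?N = "distr M borel X" and ?Y = "\<lambda>x::real ^ 'n. x"
  have m: "(\<lambda>x::real ^ 'n. \<chi> i. x $ \<pi> i) \<in> borel_measurable borel" for \<pi> :: "'n \<Rightarrow> 'n"
    by (intro borel_measurable_continuous_onI continuous_intros)
  have s: "(\<lambda>x::real ^ 'n. \<Sum>i\<in>UNIV. x $ i) \<in> borel_measurable borel"
    by (intro borel_measurable_continuous_onI continuous_intros)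
  have "prob_space ?N" using M X by (rule prob_space.prob_space_distr)
  moreover have "exchangeable ?N ?Y"
    using ex X m by (simp add: exchangeable_def distr_distr comp_def)
  moreover have "joint_mix ?N ?Y \<mu>"
    using jm X s by (simp add: joint_mix_def AE_distr_iff)
  moreover have "negatively_associated ?N ?Y"
    unfolding negatively_associated_def
  proof (intro allI impI)
    fix A B :: "'n set" and f g :: "('n \<Rightarrow> real) \<Rightarrow> real"
    assume h: "A \<inter> B = {}" "mono_on (A \<rightarrow>\<^sub>E UNIV) f" "mono_on (B \<rightarrow>\<^sub>E UNIV) g"
    assume F: "finite_second_moment ?N (\<lambda>x. f (subvector A x))"
      and G: "finite_second_moment ?N (\<lambda>x. g (subvector B x))"
    from F have fm: "(\<lambda>x. f (subvector A x)) \<in> borel_measurable borel"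
      by (simp add: finite_second_moment_def)
    from G have gm: "(\<lambda>x. g (subvector B x)) \<in> borel_measurable borel"
      by (simp add: finite_second_moment_def)
    have "finite_second_moment M (\<lambda>\<omega>. f (subvector A (X \<omega>)))"
      using F fm X measurable_compose[OF X fm]
      by (simp add: finite_second_moment_def integrable_distr_eq)
    moreover have "finite_second_moment M (\<lambda>\<omega>. g (subvector B (X \<omega>)))"
      using G gm X measurable_compose[OF X gm]
      by (simp add: finite_second_moment_def integrable_distr_eq)
    ultimately have "covariance M (\<lambda>\<omega>. f (subvector A (X \<omega>))) (\<lambda>\<omega>. g (subvector B (X \<omega>))) \<le> 0"
      using na h unfolding negatively_associated_def by blast
    then show "covariance ?N (\<lambda>x. f (subvector A x)) (\<lambda>x. g (subvector B x)) \<le> 0"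
      using X fm gm by (simp add: covariance_def integral_distr)
  qed
  moreover have "distr ?N borel ?Y = ?N"
    by (rule distr_id2) simp
  ultimately show ?thesis
    unfolding exchangeable_NA_joint_mix_laws_def mem_Collect_eq
    by (intro exI[of _ ?N] exI[of _ ?Y]) auto
qed

end

theory Submission
  imports Defs
begin

text \<open>
  Condition the random vector on the multiset of its values: by exchangeability it becomes a
  uniformly random rearrangement of a fixed vector \<open>x\<close>, which is an exchangeable joint mix. Negative
  association of a random rearrangement (Joag-Dev and Proschan) is proved by induction on the
  number of permuted coordinates, conditioning on the position \<open>b\<close> of a largest value. The
  conditional covariances are nonpositive by induction. The conditional mean of \<open>f(X\<^sub>A)\<close> does not
  depend on \<open>b\<close> as long as \<open>b \<notin> A\<close> and can only be larger if \<open>b \<in> A\<close>; since \<open>A\<close> and \<open>B\<close> are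
  disjoint, the conditional means of \<open>f(X\<^sub>A)\<close> and \<open>g(X\<^sub>B)\<close> are oppositely ordered as functions of \<open>b\<close>,
  and Chebyshev's sum inequality applies.
\<close>

section \<open>Negative association of random rearrangements\<close>

text \<open>Says at once that \<open>f\<close> is increasing and that it depends only on the coordinates in \<open>A\<close>.\<close>

definition increasing_in :: "'i set \<Rightarrow> (('i \<Rightarrow> real) \<Rightarrow> real) \<Rightarrow> bool" where
  "increasing_in A f \<longleftrightarrow> (\<forall>y z. (\<forall>i\<in>A. y i \<le> z i) \<longrightarrow> f y \<le> f z)"

lemma increasing_inD: "increasing_in A f \<Longrightarrow> (\<And>i. i \<in> A \<Longrightarrow> y i \<le> z i) \<Longrightarrow> f y \<le> f z"
  unfolding increasing_in_def by blast

text \<open>Reading \<open>x \<circ> (q \<circ> t)\<close> as \<open>(x \<circ> q) \<circ> t\<close>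
  moves a transposition \<open>t\<close> from the argument into the function, so that the induction
  hypothesis applies with \<open>t\<close> A\<open>and\<close>t \<open>B\<close>.\<close>

lemma increasing_in_comp:
  assumes "increasing_in A f"
  shows "increasing_in (t ` A) (\<lambda>y. f (y \<circ> t))"
  using assms unfolding increasing_in_def by simp

text \<open>The double sum of \<open>(F i - F j) * (G i - G j)\<close> is nonpositive and equals
  twice the difference of the two sides.\<close>

lemma Chebyshev_sum_oppositely_ordered:
  fixes F G :: "'i \<Rightarrow> real"
  assumes "\<And>i j. i \<in> P \<Longrightarrow> j \<in> P \<Longrightarrow> (F i - F j) * (G i - G j) \<le> 0"
  shows "real (card P) * (\<Sum>i\<in>P. F i * G i) \<le> (\<Sum>i\<in>P. F i) * (\<Sum>i\<in>P. G i)"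
proof -
  have "(\<Sum>i\<in>P. \<Sum>j\<in>P. (F i - F j) * (G i - G j)) \<le> 0"
    using assms by (intro sum_nonpos) auto
  also have "(\<Sum>i\<in>P. \<Sum>j\<in>P. (F i - F j) * (G i - G j))
      = (\<Sum>i\<in>P. \<Sum>j\<in>P. F i * G i) + (\<Sum>i\<in>P. \<Sum>j\<in>P. F j * G j)
        - (\<Sum>i\<in>P. \<Sum>j\<in>P. F i * G j) - (\<Sum>i\<in>P. \<Sum>j\<in>P. F j * G i)"
    unfolding sum.distrib [symmetric] sum_subtractf [symmetric]
    by (intro sum.cong refl) (simp add: algebra_simps)
  also have "(\<Sum>i\<in>P. \<Sum>j\<in>P. F j * G i) = (\<Sum>i\<in>P. \<Sum>j\<in>P. F i * G j)"
    by (rule sum.swap)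
  also have "(\<Sum>i\<in>P. \<Sum>j\<in>P. F i * G i) = real (card P) * (\<Sum>i\<in>P. F i * G i)"
    by (simp add: sum_distrib_left)
  also have "(\<Sum>i\<in>P. \<Sum>j\<in>P. F j * G j) = real (card P) * (\<Sum>i\<in>P. F i * G i)"
    by simp
  also have "(\<Sum>i\<in>P. \<Sum>j\<in>P. F i * G j) = (\<Sum>i\<in>P. F i) * (\<Sum>i\<in>P. G i)"
    by (simp add: sum_product)
  finally show ?thesis by linarith
qed

text \<open>The permutation \<open>q \<circ> transpose a b\<close> sends \<open>b\<close> to \<open>a\<close>.\<close>

lemma sum_permutations_by_preimage:
  fixes F :: "('i \<Rightarrow> 'i) \<Rightarrow> real"
  assumes "finite S" and "a \<notin> S"
  shows "(\<Sum>p | p permutes insert a S. F p)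
    = (\<Sum>b\<in>insert a S. \<Sum>q | q permutes S. F (q \<circ> Transposition.transpose a b))"
proof -
  \<comment> \<open>\<open>sum_over_permutations_insert\<close> splits by the image of
    \<open>a\<close>; inverting before and after turns this into a split by the preimage of
    \<open>a\<close>.\<close>
  have "(\<Sum>p | p permutes insert a S. F p) = (\<Sum>p | p permutes insert a S. F (inv p))"
    by (rule sum_permutations_inverse)
  also have "\<dots> = (\<Sum>b\<in>insert a S. \<Sum>q | q permutes S. F (inv (Transposition.transpose a b \<circ> q)))"
    using assms by (rule sum_over_permutations_insert)
  also have "\<dots> = (\<Sum>b\<in>insert a S. \<Sum>q | q permutes S. F (inv q \<circ> Transposition.transpose a b))"
    by (intro sum.cong refl) (simp add: o_inv_distrib permutes_bij)
  also have "\<dots> = (\<Sum>b\<in>insert a S. \<Sum>q | q permutes S. F (q \<circ> Transposition.transpose a b))"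
    by (intro sum.cong refl sum_permutations_inverse [symmetric])
  finally show ?thesis .
qed

text \<open>A bijection \<open>q\<close> to \<open>q \<circ> s\<close> pairs arrangements having
  \<open>x a\<close> at \<open>b'\<close> with arrangements having it at \<open>b\<close>. Paired
  ones agree off \<open>b\<close> and \<open>b'\<close>; \<open>f\<close> does not see
  \<open>b'\<close>, and at \<open>b\<close> the second one has the largest value.\<close>

lemma sum_rearrangements_mono:
  fixes x :: "'i \<Rightarrow> real"
  assumes f: "increasing_in A f"
    and a: "a \<notin> S" and max: "\<And>i. i \<in> S \<Longrightarrow> x i \<le> x a"
    and b: "b \<in> insert a S" and b': "b' \<in> insert a S" "b' \<notin> A"
  shows "(\<Sum>q | q permutes S. f (x \<circ> (q \<circ> Transposition.transpose a b')))
    \<le> (\<Sum>q | q permutes S. f (x \<circ> (q \<circ> Transposition.transpose a b)))"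
proof -
  \<comment> \<open>If \<open>a\<close> differs from both \<open>b\<close> and \<open>b'\<close>,
    coordinate \<open>a\<close> holds \<open>x (q b')\<close> on the left but \<open>x (q b)\<close>
    on the right; the swap \<open>s\<close> repairs this. Otherwise nothing needs repair.\<close>
  define s where "s = (if b = a \<or> b' = a then id else Transposition.transpose b b')"
  have s: "s permutes S"
    using b b' by (auto simp: s_def intro: permutes_swap_id permutes_id)
  have "(\<Sum>q | q permutes S. f (x \<circ> (q \<circ> Transposition.transpose a b')))
      \<le> (\<Sum>q | q permutes S. f (x \<circ> ((q \<circ> s) \<circ> Transposition.transpose a b)))"
  proof (intro sum_mono increasing_inD [OF f])
    fix q i assume q: "q \<in> {q. q permutes S}" and i: "i \<in> A"
    have qa: "q a = a" and sa: "s a = a"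
      using q s a by (auto simp: permutes_def)
    have le: "x (q j) \<le> x a" if "j \<in> insert a S" for j
      using that q qa max permutes_in_image[of q S j] by auto
    consider "i = b" | "i = a" "i \<noteq> b" | "i \<noteq> a" "i \<noteq> b" by blast
    then show "(x \<circ> (q \<circ> Transposition.transpose a b')) i \<le> (x \<circ> ((q \<circ> s) \<circ> Transposition.transpose a b)) i"
    proof cases
      case 1
      have "Transposition.transpose a b' b \<in> insert a S"
        using b b' by (auto simp: Transposition.transpose_def)
      then show ?thesis using 1 le qa sa by simp
    next
      case 2
      then show ?thesis using i b' by (auto simp: s_def)
    next
      case 3
      then have "i \<noteq> b'" using i b' by auto
      then show ?thesis using 3 by (simp add: s_def)
    qed
  qed
  also have "\<dots> = (\<Sum>q | q permutes S. f (x \<circ> (q \<circ> Transposition.transpose a b)))"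
    by (rule sum_permutations_compose_right [OF s, symmetric])
  finally show ?thesis .
qed

text \<open>Dividing by the squared factorial gives nonpositive covariance. Only \<open>P\<close>
  shrinks in the induction: \<open>A\<close> and \<open>B\<close> are moved by transpositions but
  never cut down, since coordinates outside \<open>P\<close> hold constants.\<close>

lemma rearrangements_negatively_associated:
  fixes x :: "'i \<Rightarrow> real"
  assumes "finite P" and "A \<inter> B = {}" and "increasing_in A f" and "increasing_in B g"
  shows "fact (card P) * (\<Sum>p | p permutes P. f (x \<circ> p) * g (x \<circ> p))
    \<le> (\<Sum>p | p permutes P. f (x \<circ> p)) * (\<Sum>p | p permutes P. g (x \<circ> p))"
  using assms
proof (induction "card P" arbitrary: P A B f g)
  case 0
  then show ?case by simp
next
  case (Suc n)
  note f = Suc.prems(3) and g = Suc.prems(4)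
  have "P \<noteq> {}" using Suc.hyps(2) by auto
  then obtain a where a: "a \<in> P" and max: "\<And>i. i \<in> P \<Longrightarrow> x i \<le> x a"
    using Max_in[of "x ` P"] Max_ge[of "x ` P"] \<open>finite P\<close>
    by (metis (no_types, lifting) finite_imageI image_iff image_is_empty)
  define S where "S = P - {a}"
  have S: "finite S" "a \<notin> S" "P = insert a S" "n = card S"
    using Suc.hyps(2) \<open>finite P\<close> a by (auto simp: S_def)
  \<comment> \<open>Up to the factor \<open>fact n\<close>, these are the conditional means of
    \<open>f\<close>, \<open>g\<close> and their product, given that the value \<open>x a\<close>
    sits at \<open>b\<close>.\<close>
  define F where "F b = (\<Sum>q | q permutes S. f (x \<circ> (q \<circ> Transposition.transpose a b)))" for b
  define G where "G b = (\<Sum>q | q permutes S. g (x \<circ> (q \<circ> Transposition.transpose a b)))" for b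
  define H where "H b = (\<Sum>q | q permutes S.
    f (x \<circ> (q \<circ> Transposition.transpose a b)) * g (x \<circ> (q \<circ> Transposition.transpose a b)))" for b
  have IH: "fact n * H b \<le> F b * G b" for b
  proof -
    have "Transposition.transpose a b ` A \<inter> Transposition.transpose a b ` B = {}"
      using \<open>A \<inter> B = {}\<close> by (simp add: image_Int [OF inj_transpose, symmetric])
    from Suc.hyps(1) [OF S(4) S(1) this increasing_in_comp [OF f] increasing_in_comp [OF g]]
    show ?thesis
      by (simp add: F_def G_def H_def S(4) comp_assoc)
  qed
  have Fle: "F b' \<le> F b" if "b \<in> P" "b' \<in> P" "b' \<notin> A" for b b'
    unfolding F_def using that S max by (intro sum_rearrangements_mono [OF f]) auto
  have Gle: "G b' \<le> G b" if "b \<in> P" "b' \<in> P" "b' \<notin> B" for b b'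
    unfolding G_def using that S max by (intro sum_rearrangements_mono [OF g]) auto
  \<comment> \<open>If \<open>i\<close> and \<open>j\<close> both avoid \<open>A\<close>, then
    \<open>F i = F j\<close>; if both avoid \<open>B\<close>, then \<open>G i = G j\<close>.
    Otherwise one lies in \<open>A\<close> and the other in \<open>B\<close>, and the differences
    have opposite signs.\<close>
  have opp: "(F i - F j) * (G i - G j) \<le> 0" if "i \<in> P" "j \<in> P" for i j
    using that Fle[of i j] Fle[of j i] Gle[of i j] Gle[of j i] \<open>A \<inter> B = {}\<close>
    by (cases "i \<in> A"; cases "j \<in> A"; cases "i \<in> B"; cases "j \<in> B")
       (auto simp: mult_le_0_iff)
  have "fact (card P) * (\<Sum>b\<in>P. H b) = real (card P) * (\<Sum>b\<in>P. fact n * H b)"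
    by (simp add: Suc.hyps(2) [symmetric] mult_ac flip: sum_distrib_left)
  also have "\<dots> \<le> real (card P) * (\<Sum>b\<in>P. F b * G b)"
    by (intro mult_left_mono sum_mono IH) auto
  also have "\<dots> \<le> (\<Sum>b\<in>P. F b) * (\<Sum>b\<in>P. G b)"
    by (rule Chebyshev_sum_oppositely_ordered [OF opp])
  finally show ?case
    unfolding S(3) sum_permutations_by_preimage [OF S(1,2)]
    by (simp only: F_def G_def H_def)
qed

section \<open>The law of a random rearrangement\<close>

abbreviation uniform_permutation :: "('i::finite \<Rightarrow> 'i) measure" where
  "uniform_permutation \<equiv> measure_pmf (pmf_of_set {p. p permutes UNIV})"

definition rearrange :: "real ^ 'n \<Rightarrow> ('n \<Rightarrow> 'n) \<Rightarrow> real ^ 'n" where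
  "rearrange x p = (\<chi> i. x $ p i)"

definition rearrangement_law :: "real ^ 'n \<Rightarrow> (real ^ 'n) measure" where
  "rearrangement_law x = distr uniform_permutation borel (rearrange x)"

lemma permutations_UNIV:
  "finite {p :: 'i::finite \<Rightarrow> 'i. p permutes UNIV}" "{p :: 'i::finite \<Rightarrow> 'i. p permutes UNIV} \<noteq> {}"
  using permutes_id[of UNIV] by (simp, blast)

lemma integral_uniform_permutation:
  fixes F :: "('i::finite \<Rightarrow> 'i) \<Rightarrow> real"
  shows "integral\<^sup>L uniform_permutation F = (\<Sum>p | p permutes UNIV. F p) / fact CARD('i)"
  by (simp add: integral_pmf_of_set [OF permutations_UNIV(2,1)] card_permutations)

lemma measurable_rearrange: "(\<lambda>x. rearrange x p) \<in> borel_measurable borel"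
  unfolding rearrange_def by (intro borel_measurable_continuous_onI continuous_intros)

text \<open>Off \<open>A\<close> both restrictions equal \<open>undefined\<close>, so their
  pointwise order is decided on \<open>A\<close> alone.\<close>

lemma increasing_in_restrict:
  assumes "mono_on (A \<rightarrow>\<^sub>E UNIV) f"
  shows "increasing_in A (\<lambda>y. f (restrict y A))"
  using assms unfolding increasing_in_def
  by (auto intro!: mono_onD[of "A \<rightarrow>\<^sub>E UNIV" f] simp: le_fun_def restrict_def)

lemma negatively_associated_rearrange:
  fixes x :: "real ^ 'n"
  shows "negatively_associated uniform_permutation (rearrange x)"
  unfolding negatively_associated_def
proof (intro allI impI)
  fix A B :: "'n set" and f g :: "('n \<Rightarrow> real) \<Rightarrow> real"
  assume disj: "A \<inter> B = {}" and f: "mono_on (A \<rightarrow>\<^sub>E UNIV) f" and g: "mono_on (B \<rightarrow>\<^sub>E UNIV) g"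
  define F where "F = (\<lambda>p. f (subvector A (rearrange x p)))"
  define G where "G = (\<lambda>p. g (subvector B (rearrange x p)))"
  let ?E = "integral\<^sup>L (uniform_permutation :: ('n \<Rightarrow> 'n) measure)"
  have int: "integrable uniform_permutation h" for h :: "('n \<Rightarrow> 'n) \<Rightarrow> real"
    using permutations_UNIV by (intro integrable_measure_pmf_finite) simp
  have F': "F p = f (restrict (($) x \<circ> p) A)" and G': "G p = g (restrict (($) x \<circ> p) B)" for p
    by (auto simp: F_def G_def subvector_def rearrange_def comp_def)
  have "fact CARD('n) * (\<Sum>p | p permutes UNIV. F p * G p)
      \<le> (\<Sum>p | p permutes UNIV. F p) * (\<Sum>p | p permutes UNIV. G p)"
    unfolding F' G'
    by (rule rearrangements_negatively_associated
        [OF finite disj increasing_in_restrict[OF f] increasing_in_restrict[OF g]])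
  then have "?E (\<lambda>p. F p * G p) \<le> ?E F * ?E G"
    unfolding integral_uniform_permutation by (simp add: field_simps)
  moreover have "(\<lambda>p. (F p - ?E F) * (G p - ?E G))
      = (\<lambda>p. F p * G p - ?E G * F p - ?E F * G p + ?E F * ?E G)"
    by (auto simp: algebra_simps)
  then have "covariance uniform_permutation F G = ?E (\<lambda>p. F p * G p) - ?E F * ?E G"
    unfolding covariance_def
    by (simp add: int measure_pmf.prob_space mult.commute)
  ultimately have "covariance uniform_permutation F G \<le> 0"
    by simp
  then show "covariance uniform_permutation (\<lambda>p. f (subvector A (rearrange x p)))
      (\<lambda>p. g (subvector B (rearrange x p))) \<le> 0"
    by (simp only: F_def G_def)
qed

text \<open>Permuting the coordinates of \<open>rearrange x p\<close> by \<open>r\<close> gives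
  \<open>rearrange x (p \<circ> r)\<close>, and right composition with \<open>r\<close> preserves
  the uniform law.\<close>

lemma exchangeable_rearrange:
  fixes x :: "real ^ 'n"
  shows "exchangeable uniform_permutation (rearrange x)"
  unfolding exchangeable_def
proof (intro allI impI)
  fix r :: "'n \<Rightarrow> 'n" assume r: "r permutes UNIV"
  have "bij_betw (\<lambda>p. p \<circ> r) {p. p permutes UNIV} {p. p permutes UNIV}"
    using r by (intro bij_betwI[where g = "\<lambda>p. p \<circ> inv r"])
      (auto intro: permutes_compose permutes_inv simp: comp_assoc permutes_inv_o)
  then have "map_pmf (\<lambda>p. p \<circ> r) (pmf_of_set {p. p permutes UNIV}) = pmf_of_set {p. p permutes UNIV}"
    by (rule map_pmf_of_set_bij_betw [OF _ permutations_UNIV(2,1)])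
  then have "(uniform_permutation :: ('n \<Rightarrow> 'n) measure)
      = distr uniform_permutation (count_space UNIV) (\<lambda>p. p \<circ> r)"
    by (metis map_pmf_rep_eq)
  then have "distr uniform_permutation borel (rearrange x)
      = distr (distr uniform_permutation (count_space UNIV) (\<lambda>p. p \<circ> r)) borel (rearrange x)"
    by simp
  also have "\<dots> = distr uniform_permutation borel (\<lambda>p. \<chi> i. rearrange x p $ r i)"
    by (subst distr_distr) (auto simp: comp_def rearrange_def)
  finally show "distr uniform_permutation borel (\<lambda>p. \<chi> i. rearrange x p $ r i)
      = distr uniform_permutation borel (rearrange x)" ..
qed

lemma joint_mix_rearrange:
  assumes "(\<Sum>i\<in>UNIV. x $ i) = \<mu>"
  shows "joint_mix uniform_permutation (rearrange x) \<mu>"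
proof -
  have "(\<Sum>i\<in>UNIV. x $ p i) = \<mu>" if "p permutes UNIV" for p
    using sum.permute [OF that, of "($) x"] assms by (simp add: comp_def)
  then show ?thesis
    by (simp add: joint_mix_def AE_measure_pmf_iff rearrange_def
        set_pmf_of_set [OF permutations_UNIV(2,1)])
qed

lemma rearrangement_law_in_laws:
  assumes "(\<Sum>i\<in>UNIV. x $ i) = \<mu>"
  shows "rearrangement_law x \<in> exchangeable_NA_joint_mix_laws \<mu>"
  unfolding rearrangement_law_def
  using measure_pmf.prob_space_axioms exchangeable_rearrange negatively_associated_rearrange
    joint_mix_rearrange[OF assms]
  by (intro distr_in_exchangeable_NA_joint_mix_laws) auto

text \<open>This finite average reduces measurability in \<open>x\<close> and integration over
  \<open>x\<close> to one fixed permutation at a time.\<close>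

lemma emeasure_rearrangement_law:
  fixes x :: "real ^ 'n"
  assumes "A \<in> sets borel"
  shows "emeasure (rearrangement_law x) A
    = (\<Sum>p | p permutes UNIV. indicator A (rearrange x p)) / fact CARD('n)"
proof -
  have "emeasure (rearrangement_law x) A
      = (\<integral>\<^sup>+p. indicator A (rearrange x p) \<partial>uniform_permutation)"
    using assms by (simp add: rearrangement_law_def nn_integral_distr flip: nn_integral_indicator)
  then show ?thesis
    by (simp add: nn_integral_pmf_of_set [OF permutations_UNIV(2,1)] card_permutations)
qed

lemma measurable_rearrangement_law: "rearrangement_law \<in> borel \<rightarrow>\<^sub>M prob_algebra borel"
proof (rule measurable_prob_algebraI)
  show prob: "prob_space (rearrangement_law x)" for x :: "real ^ 'n"
    unfolding rearrangement_law_def by (intro measure_pmf.prob_space_distr) simp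
  show "rearrangement_law \<in> borel \<rightarrow>\<^sub>M subprob_algebra (borel :: (real ^ 'n) measure)"
  proof (rule measurable_subprob_algebra)
    fix A :: "(real ^ 'n) set" assume A: "A \<in> sets borel"
    have "(\<lambda>x. indicator A (rearrange x p) :: ennreal) \<in> borel_measurable borel" for p
      using measurable_compose [OF measurable_rearrange borel_measurable_indicator [OF A]] .
    then show "(\<lambda>x. emeasure (rearrangement_law x) A) \<in> borel_measurable borel"
      unfolding emeasure_rearrangement_law [OF A] by measurable
  qed (simp_all add: prob prob_space_imp_subprob_space, simp add: rearrangement_law_def)
qed

section \<open>Exchangeable laws as mixtures of rearrangement laws\<close>

theorem proposition4:
  fixes M :: "'a measure" and X :: "'a \<Rightarrow> real ^ 'n" and \<mu> :: real and G :: "(real ^ 'n) measure"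
  assumes "prob_space M" and "X \<in> borel_measurable M"
    and "exchangeable M X" and "joint_mix M X \<mu>"
    and "G = distr M borel X"
  shows "\<exists>(\<nu> :: (real ^ 'n) measure) (U :: real ^ 'n \<Rightarrow> (real ^ 'n) measure).
           is_mixture \<nu> U (exchangeable_NA_joint_mix_laws \<mu>) G"
proof -
  interpret M: prob_space M by fact
  note X = \<open>X \<in> borel_measurable M\<close> and G = \<open>G = distr M borel X\<close>
  \<comment> \<open>The mixing measure is \<open>G\<close> itself: draw \<open>x\<close> from
    \<open>G\<close>, then shuffle its coordinates.\<close>
  have "is_mixture G rearrangement_law (exchangeable_NA_joint_mix_laws \<mu>) G"
    unfolding is_mixture_def
  proof (intro conjI ballI)
    show "sets G = sets borel" by (simp add: G)
    show "prob_space G" unfolding G using X by (rule M.prob_space_distr)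
    show "rearrangement_law \<in> G \<rightarrow>\<^sub>M prob_algebra borel"
      using measurable_rearrangement_law by (simp add: G)
    have "(\<lambda>x::real ^ 'n. \<Sum>i\<in>UNIV. x $ i) \<in> borel_measurable borel"
      by (intro borel_measurable_continuous_onI continuous_intros)
    then have "AE x in distr M borel X. (\<Sum>i\<in>UNIV. x $ i) = \<mu>"
      using \<open>joint_mix M X \<mu>\<close> X by (simp add: joint_mix_def AE_distr_iff)
    then have "AE x in G. (\<Sum>i\<in>UNIV. x $ i) = \<mu>"
      by (simp only: G)
    then show "AE x in G. rearrangement_law x \<in> exchangeable_NA_joint_mix_laws \<mu>"
      by eventually_elim (rule rearrangement_law_in_laws)
  next
    fix A :: "(real ^ 'n) set" assume A: "A \<in> sets borel"
    have m: "(\<lambda>x. indicator A (rearrange x p) :: ennreal) \<in> borel_measurable G" for p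
      using measurable_compose [OF measurable_rearrange borel_measurable_indicator [OF A]]
      by (simp add: G)
    \<comment> \<open>Exchangeability enters here: each fixed permutation preserves
      \<open>G\<close>, so every term of the average contributes
      \<open>emeasure G A\<close>.\<close>
    have inv: "(\<integral>\<^sup>+x. indicator A (rearrange x p) \<partial>G) = emeasure G A" if p: "p permutes UNIV" for p
    proof -
      have "distr G borel (\<lambda>x. rearrange x p) = G"
        using \<open>exchangeable M X\<close> p X measurable_rearrange[of p]
        by (simp add: G exchangeable_def distr_distr comp_def rearrange_def)
      then have "emeasure G A = (\<integral>\<^sup>+x. indicator A x \<partial>distr G borel (\<lambda>x. rearrange x p))"
        using A by (simp add: G)
      also have "\<dots> = (\<integral>\<^sup>+x. indicator A (rearrange x p) \<partial>G)"
        using A measurable_rearrange[of p] by (intro nn_integral_distr) (simp_all add: G)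
      finally show ?thesis ..
    qed
    have "(\<integral>\<^sup>+x. emeasure (rearrangement_law x) A \<partial>G)
        = (\<Sum>p | p permutes UNIV. \<integral>\<^sup>+x. indicator A (rearrange x p) \<partial>G) / fact CARD('n)"
      unfolding emeasure_rearrangement_law [OF A]
      using m by (simp add: nn_integral_divide nn_integral_sum)
    also have "\<dots> = fact CARD('n) * emeasure G A / fact CARD('n)"
      by (simp add: inv card_permutations)
    also have "\<dots> = emeasure G A"
      \<comment> \<open>Cancelling in \<open>ennreal\<close> needs a nonzero finite factor, which is
        evident for the image of a natural number.\<close>
      unfolding of_nat_fact [where 'a = ennreal, symmetric]
      by (subst mult.commute, intro ennreal_mult_divide_eq)
        (simp_all del: of_nat_fact)
    finally show "emeasure G A = (\<integral>\<^sup>+x. emeasure (rearrangement_law x) A \<partial>G)" ..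
  qed
  then show ?thesis by blast
qed

end
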